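(* Let $\{A,B,C,D\}$ be a set of four (distinct) Pauli operators on a common system of qubits. Then $\{A,B,C,D\}$ is contextual if and only if, up to a permutation of the four operators, its compatibility graph is one of the following three graphs on the vertices $A,B,C,D$: (i) the graph with edge set $\{AB, AC\}$ (a path on three vertices together with the isolated vertex $D$); (ii) the graph with edge set $\{AB, AC, BD\}$ (a path on four vertices); (iii) the graph with edge set $\{AB, AC, BD, CD\}$ (a 4-cycle).
   Context: Pauli operators: fix a number of qubits $N\ge 1$. A Pauli operator is an operator $\pm\, P_1\otimes\cdots\otimes P_N$ with each $P_i\in\{I,X,Y,Z\}$ (the $2\times 2$ identity and the Pauli matrices). Any two Pauli operators either commute or anticommute, and each squares to the identity. Operators are compared including their sign, so $A$ and $-A$ are different operators. Determining tree: a determining tree for a Pauli operator $A$ over a set $\mathcal{S}$ of Pauli operators is a finite rooted tree whose nodes are (labelled by) Pauli operators, with repetitions allowed, and whose leaves are operators in $\mathcal{S}$, such that (1) the root is $A$; (2) all children of any particular parent pairwise commute as operators; (3) every parent node is the operator product of its children. (A single node $B\in\mathcal{S}$ is a determining tree for $B$.) Determining set: the determining set of a determining tree is the set containing one copy of each operator that occurs with odd multiplicity as a leaf of the tree. Contextual: a set $\mathcal{S}$ of Pauli operators is contextual if for some Pauli operator $A$ there exist a determining tree $\tau$ for $A$ over $\mathcal{S}$ and a determining tree $\tau'$ for $-A$ over $\mathcal{S}$ such that the determining sets of $\tau$ and $\tau'$ are identical. Otherwise it is noncontextual. Compatibility graph: the compatibility graph of a set $\mathcal{S}$ of Pauli operators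 is the undirected graph whose vertices are the operators in $\mathcal{S}$, with two distinct operators adjacent if and only if they commute. *)

theory Defs
  imports "HOL-Analysis.Analysis" "HOL-Library.Multiset" "HOL-Combinatorics.Permutations"
begin

text \<open>
  The qubits are labelled by a finite type \<open>'n\<close>, so \<open>N = CARD('n) \<ge> 1\<close>.  The
  computational basis of the \<open>N\<close>-qubit space is indexed by the vectors in \<open>2 ^ 'n\<close>
  (one two-valued label per qubit), and operators are complex matrices over that basis.
\<close>

type_synonym 'n qop = "complex ^ (2 ^ 'n) ^ (2 ^ 'n)"

definition pauli_I :: "complex ^ 2 ^ 2" where
  "pauli_I = mat 1"

definition pauli_X :: "complex ^ 2 ^ 2" where
  "pauli_X = vector [vector [0, 1], vector [1, 0]]"

definition pauli_Y :: "complex ^ 2 ^ 2" where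
  "pauli_Y = vector [vector [0, - \<i>], vector [\<i>, 0]]"

definition pauli_Z :: "complex ^ 2 ^ 2" where
  "pauli_Z = vector [vector [1, 0], vector [0, - 1]]"

text \<open>
  The Kronecker product of one matrix per qubit: its entry at row \<open>s\<close>, column \<open>t\<close> is the
  product of the entries of the factors at row \<open>s\<^sub>i\<close>, column \<open>t\<^sub>i\<close>.
\<close>

definition tensor :: "('n \<Rightarrow> complex ^ 2 ^ 2) \<Rightarrow> 'n::finite qop" where
  "tensor P = (\<chi> s t. \<Prod>i\<in>UNIV. P i $ (s $ i) $ (t $ i))"

definition pauli_ops :: "'n::finite qop set" where
  "pauli_ops = {A. \<exists>P. (\<forall>i. P i \<in> {pauli_I, pauli_X, pauli_Y, pauli_Z}) \<and>
                       (A = tensor P \<or> A = - tensor P)}"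

definition commute :: "'n::finite qop \<Rightarrow> 'n qop \<Rightarrow> bool" where
  "commute A B \<longleftrightarrow> A ** B = B ** A"

datatype 'a rtree = Node (root: 'a) (children: "'a rtree list")

fun leaves :: "'a rtree \<Rightarrow> 'a multiset" where
  "leaves (Node a ts) = (if ts = [] then {#a#} else \<Sum>\<^sub># (mset (map leaves ts)))"

text \<open>
  A node without children is a leaf and must lie in \<open>S\<close>; hence the condition \<open>ts \<noteq> []\<close>,
  without which the identity would be available as an empty product.  The children form a
  list, whose order does not affect the product since they commute.
\<close>

inductive determining_tree :: "'n::finite qop set \<Rightarrow> 'n qop rtree \<Rightarrow> bool"
  for S :: "'n qop set" where
  leaf: "B \<in> pauli_ops \<Longrightarrow> B \<in> S \<Longrightarrow> determining_tree S (Node B [])"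
| parent: "A \<in> pauli_ops \<Longrightarrow> ts \<noteq> [] \<Longrightarrow> (\<forall>t\<in>set ts. determining_tree S t) \<Longrightarrow>
    (\<forall>s\<in>set ts. \<forall>t\<in>set ts. commute (root s) (root t)) \<Longrightarrow>
    A = foldr (**) (map root ts) (mat 1) \<Longrightarrow> determining_tree S (Node A ts)"

definition determining_set :: "'a rtree \<Rightarrow> 'a set" where
  "determining_set \<tau> = {B. odd (count (leaves \<tau>) B)}"

definition contextual :: "'n::finite qop set \<Rightarrow> bool" where
  "contextual S \<longleftrightarrow> (\<exists>A\<in>pauli_ops. \<exists>\<tau> \<tau>'.
     determining_tree S \<tau> \<and> root \<tau> = A \<and>
     determining_tree S \<tau>' \<and> root \<tau>' = - A \<and>
     determining_set \<tau> = determining_set \<tau>')"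

text \<open>An undirected graph is given by its vertex set and its set of two-element edges.\<close>

definition compatibility_graph :: "'n::finite qop set \<Rightarrow> 'n qop set \<times> 'n qop set set" where
  "compatibility_graph S = (S, {{P, Q} | P Q. P \<in> S \<and> Q \<in> S \<and> P \<noteq> Q \<and> commute P Q})"

end

(*
  A set S of Pauli operators is contextual iff it contains a, b, c, d such that a commutes with
  b and c, while b, c anticommute and a, d anticommute; on four vertices this pattern
  leaves exactly the three listed graphs, since b and c may be exchanged.

  If the pattern occurs, explicit trees (the Mermin square in the case of the 4-cycle) give both
  signs.  If it does not, commutation is an equivalence relation on the set K of those operators
  that do not commute with all of S.  Let r x be a fixed representative of the class of x in K,
  and r x = 1 for the other x.  Then the operators v x = x (r x) commute with each other and
  with S, and by induction every node of a tree equals the product of the v x over the leaves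
  below it, times 1 or a representative.  As (v x)^2 = 1, the first factor depends only on the
  determining set, so two trees with equal determining sets cannot have opposite roots.
*)
theory Submission
  imports Defs
begin

section \<open>Pauli operators\<close>

text \<open>A basis label \<open>u\<close> chooses one index per qubit, so the sum over
  \<open>u\<close> is a product of one-qubit sums expanded by distributivity.\<close>

lemma tensor_mult: "tensor P ** tensor Q = tensor (\<lambda>i. P i ** Q i)"
proof -
  have "(\<Sum>u\<in>UNIV. (\<Prod>i\<in>UNIV. P i $ (s $ i) $ (u $ i)) * (\<Prod>i\<in>UNIV. Q i $ (u $ i) $ (t $ i)))
      = (\<Prod>i\<in>UNIV. \<Sum>k\<in>UNIV. P i $ (s $ i) $ k * Q i $ k $ (t $ i))" for s t :: "2 ^ 'a"
  proof -
    have "(\<Sum>u\<in>UNIV. (\<Prod>i\<in>UNIV. P i $ (s $ i) $ (u $ i)) * (\<Prod>i\<in>UNIV. Q i $ (u $ i) $ (t $ i)))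
        = (\<Sum>u\<in>UNIV. \<Prod>i\<in>UNIV. P i $ (s $ i) $ (u $ i) * Q i $ (u $ i) $ (t $ i))"
      by (simp add: prod.distrib)
    also have "\<dots> = (\<Sum>f\<in>UNIV. \<Prod>i\<in>UNIV. P i $ (s $ i) $ f i * Q i $ f i $ (t $ i))"
      by (rule sum.reindex_bij_witness[where i = vec_lambda and j = vec_nth]) auto
    also have "\<dots> = (\<Prod>i\<in>UNIV. \<Sum>k\<in>UNIV. P i $ (s $ i) $ k * Q i $ k $ (t $ i))"
      by (subst prod_sum_PiE) (auto simp: PiE_UNIV_domain)
    finally show ?thesis .
  qed
  then show ?thesis
    by (simp add: tensor_def matrix_matrix_mult_def)
qed

lemma tensor_pauli_I: "tensor (\<lambda>i. pauli_I) = mat 1"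
proof -
  have "(\<Prod>i\<in>UNIV. (if s $ i = t $ i then 1 else 0 :: complex)) = (if s = t then 1 else 0)"
    for s t :: "2 ^ 'a"
    by (auto simp: vec_eq_iff)
  then show ?thesis
    by (simp add: tensor_def pauli_I_def mat_def)
qed

section \<open>One-qubit Pauli matrices and the phases of their products\<close>

abbreviation "pauli_matrices \<equiv> {pauli_I, pauli_X, pauli_Y, pauli_Z}"

lemma pauli_entries:
  "pauli_I $ 1 $ 1 = 1" "pauli_I $ 1 $ 2 = 0" "pauli_I $ 2 $ 1 = 0" "pauli_I $ 2 $ 2 = 1"
  "pauli_X $ 1 $ 1 = 0" "pauli_X $ 1 $ 2 = 1" "pauli_X $ 2 $ 1 = 1" "pauli_X $ 2 $ 2 = 0"
  "pauli_Y $ 1 $ 1 = 0" "pauli_Y $ 1 $ 2 = -\<i>" "pauli_Y $ 2 $ 1 = \<i>" "pauli_Y $ 2 $ 2 = 0"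
  "pauli_Z $ 1 $ 1 = 1" "pauli_Z $ 1 $ 2 = 0" "pauli_Z $ 2 $ 1 = 0" "pauli_Z $ 2 $ 2 = -1"
  by (simp_all add: pauli_I_def pauli_X_def pauli_Y_def pauli_Z_def mat_def)

lemma matrix_mult_entry_2:
  fixes P Q :: "complex ^ 2 ^ 2"
  shows "(P ** Q) $ s $ t = P $ s $ 1 * Q $ 1 $ t + P $ s $ 2 * Q $ 2 $ t"
  by (simp add: matrix_matrix_mult_def sum_2)

lemma pauli_matrix_square: "P \<in> pauli_matrices \<Longrightarrow> P ** P = pauli_I"
  by (elim insertE emptyE; simp add: vec_eq_iff forall_2 matrix_mult_entry_2 pauli_entries)

text \<open>The phases of the two orders are conjugate because all the matrices are Hermitian: the
  adjoint of \<open>P ** Q\<close> is \<open>Q ** P\<close>.\<close>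

lemma pauli_matrix_mult:
  assumes "P \<in> pauli_matrices" "Q \<in> pauli_matrices"
  shows "\<exists>R\<in>pauli_matrices. \<exists>c\<in>{1, \<i>, -\<i>}. \<forall>s t.
    (P ** Q) $ s $ t = c * R $ s $ t \<and> (Q ** P) $ s $ t = cnj c * R $ s $ t"
  using assms
  by (elim insertE emptyE; simp add: forall_2 matrix_mult_entry_2 pauli_entries)

lemma uminus_pauli_ops: "A \<in> pauli_ops \<Longrightarrow> - A \<in> pauli_ops"
  by (auto simp: pauli_ops_def)

lemma matrix_mult_uminus [simp]:
  fixes A :: "'a::ring_1 ^ 'n ^ 'm" and B :: "'a ^ 'k ^ 'n"
  shows "(- A) ** B = - (A ** B)" "A ** (- B) = - (A ** B)"
  by (simp_all add: matrix_matrix_mult_def vec_eq_iff sum_negf)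

lemma pauli_square [simp]: "A \<in> pauli_ops \<Longrightarrow> A ** A = mat 1"
  by (auto simp: pauli_ops_def tensor_mult pauli_matrix_square simp flip: tensor_pauli_I)

lemma pauli_square_assoc [simp]: "A \<in> pauli_ops \<Longrightarrow> A ** (A ** X) = X"
  by (metis matrix_mul_assoc matrix_mul_lid pauli_square)

text \<open>The one-qubit phases multiply, and conjugation respects products; -1 can now arise from
  two imaginary phases.\<close>

lemma tensor_pauli_mult:
  assumes "\<And>i. P i \<in> pauli_matrices" "\<And>i. Q i \<in> pauli_matrices"
  shows "\<exists>R c. (\<forall>i. R i \<in> pauli_matrices) \<and> c \<in> {1, -1, \<i>, -\<i>} \<and> (\<forall>s t.
    (tensor P ** tensor Q) $ s $ t = c * tensor R $ s $ t \<and>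
    (tensor Q ** tensor P) $ s $ t = cnj c * tensor R $ s $ t)"
proof -
  have "\<forall>i. \<exists>R c. R \<in> pauli_matrices \<and> c \<in> {1, \<i>, -\<i>} \<and> (\<forall>s t.
    (P i ** Q i) $ s $ t = c * R $ s $ t \<and> (Q i ** P i) $ s $ t = cnj c * R $ s $ t)"
    using pauli_matrix_mult[OF assms] by meson
  then obtain R c where R: "\<And>i. R i \<in> pauli_matrices" and c: "\<And>i. c i \<in> {1, \<i>, -\<i>}"
    and eq: "\<And>i s t. (P i ** Q i) $ s $ t = c i * R i $ s $ t"
      "\<And>i s t. (Q i ** P i) $ s $ t = cnj (c i) * R i $ s $ t"
    by metis
  have phase: "prod c F \<in> {1, -1, \<i>, -\<i>}" for F
  proof (induction F rule: infinite_finite_induct)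
    case (insert i F)
    then show ?case using c[of i] by auto
  qed auto
  have "(tensor P ** tensor Q) $ s $ t = prod c UNIV * tensor R $ s $ t"
    "(tensor Q ** tensor P) $ s $ t = cnj (prod c UNIV) * tensor R $ s $ t" for s t
    by (simp_all add: tensor_mult) (simp_all add: tensor_def eq prod.distrib)
  then show ?thesis
    by (intro exI[of _ R] exI[of _ "prod c UNIV"] conjI allI R phase)
qed

lemma mat_1_neq_uminus: "(mat 1 :: complex ^ 'n ^ 'n) \<noteq> - mat 1"
proof
  assume "(mat 1 :: complex ^ 'n ^ 'n) = - mat 1"
  then have "(mat 1 :: complex ^ 'n ^ 'n) $ i $ i = (- mat 1) $ i $ i" for i by (rule arg_cong)
  then show False by (simp add: mat_def)
qed

text \<open>The phase \<open>c\<close> decides. If it is real, both orders agree and the product is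
  a signed tensor of Pauli matrices; if it is imaginary, conjugation flips the sign.\<close>

lemma pauli_anticommute:
  assumes "A \<in> pauli_ops" "B \<in> pauli_ops"
  shows "\<not> commute A B \<longleftrightarrow> A ** B = - (B ** A)" (is ?anti)
    and "commute A B \<Longrightarrow> A ** B \<in> pauli_ops" (is "_ \<Longrightarrow> ?prod")
proof -
  obtain P where P: "\<And>i. P i \<in> pauli_matrices" "A = tensor P \<or> A = - tensor P"
    using assms(1) by (auto simp: pauli_ops_def)
  obtain Q where Q: "\<And>i. Q i \<in> pauli_matrices" "B = tensor Q \<or> B = - tensor Q"
    using assms(2) by (auto simp: pauli_ops_def)
  obtain R c where R: "\<And>i. R i \<in> pauli_matrices" and c: "c \<in> {1, -1, \<i>, -\<i>}"
    and eq: "\<And>s t. (tensor P ** tensor Q) $ s $ t = c * tensor R $ s $ t"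
      "\<And>s t. (tensor Q ** tensor P) $ s $ t = cnj c * tensor R $ s $ t"
    using tensor_pauli_mult[of P Q] P(1) Q(1) by metis
  \<comment> \<open>Makes the two alternatives exclusive: cancelling \<open>A\<close> on the left
    and \<open>B\<close> on the right would give 1 = -1.\<close>
  have nonzero: "A ** B \<noteq> - (A ** B)"
  proof
    assume "A ** B = - (A ** B)"
    then have "A ** (A ** B) ** B = A ** (- (A ** B)) ** B"
      by (rule arg_cong)
    then show False
      using assms by (simp add: mat_1_neq_uminus)
  qed
  have "(A ** B = B ** A \<and> A ** B \<in> pauli_ops) \<or> A ** B = - (B ** A)"
  proof (cases "c = 1 \<or> c = -1")
    case True
    then have "cnj c = c" by auto
    then have "tensor P ** tensor Q = tensor Q ** tensor P"
      unfolding vec_eq_iff by (simp add: eq)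
    moreover have "tensor P ** tensor Q = tensor R \<or> tensor P ** tensor Q = - tensor R"
      using True unfolding vec_eq_iff by (elim disjE) (simp_all add: eq)
    then have "tensor P ** tensor Q \<in> pauli_ops"
      using R unfolding pauli_ops_def by blast
    ultimately show ?thesis
      using P(2) Q(2) by (elim disjE) (simp_all add: uminus_pauli_ops)
  next
    case False
    then have "cnj c = - c" using c by auto
    then have "tensor P ** tensor Q = - (tensor Q ** tensor P)"
      unfolding vec_eq_iff by (simp add: eq)
    then show ?thesis
      using P(2) Q(2) by (elim disjE) simp_all
  qed
  then show ?anti "commute A B \<Longrightarrow> ?prod"
    using nonzero by (auto simp: commute_def)
qed

section \<open>Moving commuting and anticommuting factors past each other\<close>

lemma commute_sym: "commute A B \<longleftrightarrow> commute B A"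
  by (auto simp: commute_def)

lemma commute_refl [simp]: "commute A A"
  by (simp add: commute_def)

lemma commute_mat_1 [simp]: "commute (mat 1) A" "commute A (mat 1)"
  by (simp_all add: commute_def)

lemma commute_mult: "commute A C \<Longrightarrow> commute B C \<Longrightarrow> commute (A ** B) C"
  unfolding commute_def by (metis matrix_mul_assoc)

text \<open>Together with \<open>anticommute_swap\<close>, these rewrite a right-associated product
  into a fixed order of its factors; the version with a tail \<open>X\<close> acts inside longer
  products.\<close>

lemma commute_swap:
  assumes "commute A B"
  shows "B ** A = A ** B" "B ** (A ** X) = A ** (B ** X)"
proof -
  show "B ** A = A ** B" using assms by (simp add: commute_def)
  then show "B ** (A ** X) = A ** (B ** X)" by (simp add: matrix_mul_assoc)
qed

lemma anticommute_swap:
  assumes "A \<in> pauli_ops" "B \<in> pauli_ops" "\<not> commute A B"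
  shows "B ** A = - (A ** B)" "B ** (A ** X) = - (A ** (B ** X))"
proof -
  show "B ** A = - (A ** B)"
    using assms pauli_anticommute(1)[of B A] commute_sym by blast
  then show "B ** (A ** X) = - (A ** (B ** X))" by (simp add: matrix_mul_assoc)
qed

text \<open>Moving \<open>C\<close> past both factors produces two signs, which cancel.\<close>

lemma commute_mult_anti:
  assumes "A ** C = - (C ** A)" "B ** C = - (C ** B)"
  shows "commute (A ** B) C"
proof -
  have "A ** B ** C = A ** (B ** C)" by (simp add: matrix_mul_assoc)
  also have "\<dots> = - (A ** C ** B)" by (simp add: assms(2) matrix_mul_assoc)
  also have "\<dots> = C ** (A ** B)" by (simp add: assms(1) matrix_mul_assoc)
  finally show ?thesis by (simp add: commute_def)
qed

section \<open>Contextuality of the three graphs\<close>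

lemma determining_tree_pair:
  assumes "determining_tree S s" "determining_tree S t" "commute (root s) (root t)"
    "root s \<in> pauli_ops" "root t \<in> pauli_ops"
  shows "determining_tree S (Node (root s ** root t) [s, t])"
  using assms pauli_anticommute(2)[of "root s" "root t"]
  by (intro determining_tree.parent) (auto simp: commute_sym)

lemma contextual_pair:
  assumes "determining_tree S s" "determining_tree S t" "root s \<in> pauli_ops"
    "root t = - root s" "determining_set s = determining_set t"
  shows "contextual S"
  using assms unfolding contextual_def by blast

lemma root_determining_tree: "determining_tree S t \<Longrightarrow> root t \<in> pauli_ops"
  by (induction rule: determining_tree.induct) auto

text \<open>The last hypothesis fixes the labelling of \<open>b\<close> and \<open>c\<close> and
  leaves three cases. In each, two trees multiply out to the same word with opposite signs.\<close>

lemma contextual_of_oriented_pattern: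
  assumes S: "a \<in> S" "b \<in> S" "c \<in> S" "d \<in> S"
    and P: "a \<in> pauli_ops" "b \<in> pauli_ops" "c \<in> pauli_ops" "d \<in> pauli_ops"
    and g: "commute a b" "commute a c" "\<not> commute b c" "\<not> commute a d"
      "commute c d \<longrightarrow> commute b d"
  shows "contextual S"
proof -
  let ?l = "\<lambda>x. Node x []"
  let ?p = "\<lambda>s t. Node (root s ** root t) [s, t]"
  have l: "determining_tree S (?l a)" "determining_tree S (?l b)"
    "determining_tree S (?l c)" "determining_tree S (?l d)"
    using S P by (auto intro: determining_tree.leaf)
  have pair: "determining_tree S (?p s t)"
    if "determining_tree S s" "determining_tree S t" "commute (root s) (root t)" for s t
    using that by (intro determining_tree_pair) (auto intro: root_determining_tree)
  note swap = commute_swap[OF g(1)] commute_swap[OF g(2)]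
    anticommute_swap[OF P(2,3) g(3)] anticommute_swap[OF P(1,4) g(4)]
  have assoc: "(X ** Y) ** Z = X ** (Y ** Z)" for X Y Z :: "'a qop"
    by (simp add: matrix_mul_assoc)
  consider "commute b d" "commute c d" | "commute b d" "\<not> commute c d"
    | "\<not> commute b d" "\<not> commute c d"
    using g by blast
  then show ?thesis
  proof cases
    case 1
    note swap = swap commute_swap[OF 1(1)] commute_swap[OF 1(2)]
    \<comment> \<open>The words differ by exchanging the anticommuting \<open>b\<close> and
      \<open>c\<close>. The inner products commute because exactly two of their four cross pairs
      anticommute.\<close>
    let ?s = "?p (?p (?l a) (?l b)) (?p (?l c) (?l d))"
    let ?t = "?p (?p (?l a) (?l c)) (?p (?l b) (?l d))"
    have st: "determining_tree S ?s" "determining_tree S ?t"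
      by (intro pair l; simp add: commute_def assoc swap)+
    then show ?thesis
      by (rule contextual_pair)
        (use root_determining_tree[OF st(1)] in
          \<open>auto simp: determining_set_def assoc swap split: if_splits\<close>)
  next
    case 2
    note swap = swap commute_swap[OF 2(1)] anticommute_swap[OF P(3,4) 2(2)]
    \<comment> \<open>The two leaves \<open>b\<close> cancel in the determining set, but moving one
      past \<open>c\<close> to meet the other leaves a sign. In \<open>?t\<close>, moving
      \<open>d\<close> past \<open>a\<close> and \<open>c\<close> costs two signs.\<close>
    let ?s = "?p (?p (?l a) (?l b)) (?p (?l c) (?p (?l b) (?l d)))"
    let ?t = "?p (?l d) (?p (?l a) (?l c))"
    have st: "determining_tree S ?s" "determining_tree S ?t"
      by (intro pair l; simp add: commute_def assoc swap P)+
    then show ?thesis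
      by (rule contextual_pair)
        (use root_determining_tree[OF st(1)] in
          \<open>auto simp: determining_set_def assoc swap P split: if_splits\<close>)
  next
    case 3
    note swap = swap anticommute_swap[OF P(2,4) 3(1)] anticommute_swap[OF P(3,4) 3(2)]
    \<comment> \<open>Sorting into the order \<open>a\<close>, \<open>b\<close>, \<open>c\<close>,
      \<open>d\<close> takes one anticommutation in \<open>?s\<close> and two in
      \<open>?t\<close>.\<close>
    let ?s = "?p (?p (?p (?l a) (?l b)) (?l d)) (?l c)"
    let ?t = "?p (?p (?p (?l a) (?l c)) (?l d)) (?l b)"
    have st: "determining_tree S ?s" "determining_tree S ?t"
      by (intro pair l; simp add: commute_def assoc swap)+
    then show ?thesis
      by (rule contextual_pair)
        (use root_determining_tree[OF st(1)] in
          \<open>auto simp: determining_set_def assoc swap split: if_splits\<close>)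
  qed
qed

definition contextual_pattern :: "'n::finite qop \<Rightarrow> 'n qop \<Rightarrow> 'n qop \<Rightarrow> 'n qop \<Rightarrow> bool" where
  "contextual_pattern a b c d \<longleftrightarrow>
     commute a b \<and> commute a c \<and> \<not> commute b c \<and> \<not> commute a d"

text \<open>The pattern is symmetric in \<open>b\<close> and \<open>c\<close>, so exchanging them if
  necessary reaches the oriented form.\<close>

lemma contextual_of_pattern:
  assumes "contextual_pattern a b c d" "{a, b, c, d} \<subseteq> S" "S \<subseteq> pauli_ops"
  shows "contextual S"
proof -
  have mem: "a \<in> S" "b \<in> S" "c \<in> S" "d \<in> S" using assms(2) by auto
  then have pauli: "a \<in> pauli_ops" "b \<in> pauli_ops" "c \<in> pauli_ops" "d \<in> pauli_ops"
    using assms(3) by auto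
  have "\<not> commute c b" using assms(1) commute_sym by (metis contextual_pattern_def)
  then show ?thesis
    using assms(1) contextual_of_oriented_pattern[OF mem pauli]
      contextual_of_oriented_pattern[OF mem(1,3,2,4) pauli(1,3,2,4)]
    unfolding contextual_pattern_def by argo
qed

section \<open>Noncontextual sets\<close>

definition value_prod :: "('a \<Rightarrow> complex ^ 'm ^ 'm) \<Rightarrow> 'a multiset \<Rightarrow> complex ^ 'm ^ 'm" where
  "value_prod v M = fold_mset (\<lambda>x. (**) (v x)) (mat 1) M"

text \<open>Commutation makes the fold in \<open>value_prod\<close> independent of the order;
  squares equal to 1 make it depend on parities only.\<close>

locale commuting_involutions =
  fixes v :: "'a \<Rightarrow> complex ^ 'm ^ 'm"
  assumes comm: "v x ** v y = v y ** v x"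
    and square: "v x ** v x = mat 1"
begin

lemma square_assoc: "v x ** (v x ** X) = X"
  by (simp add: matrix_mul_assoc square)

sublocale comp_fun_commute "\<lambda>x. (**) (v x)"
  by standard (simp add: fun_eq_iff matrix_mul_assoc comm)

lemma value_prod_empty [simp]: "value_prod v {#} = mat 1"
  by (simp add: value_prod_def)

lemma value_prod_add [simp]: "value_prod v (add_mset x M) = v x ** value_prod v M"
  by (simp add: value_prod_def)

lemma value_prod_union: "value_prod v (M + N) = value_prod v M ** value_prod v N"
  by (induction M) (simp_all add: matrix_mul_assoc)

lemma value_prod_commute:
  assumes "\<And>x. v x ** X = X ** v x"
  shows "value_prod v M ** X = X ** value_prod v M"
  by (induction M) (simp, metis assms matrix_mul_assoc value_prod_add)

lemma value_prod_self: "value_prod v M ** value_prod v M = mat 1"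
proof (induction M)
  case (add x M)
  have "value_prod v M ** v x = v x ** value_prod v M"
    by (intro value_prod_commute comm)
  then show ?case
    by (metis add matrix_mul_assoc matrix_mul_lid square value_prod_add)
qed simp

text \<open>Adding \<open>x\<close> toggles its membership in the odd set, and a second factor
  \<open>v x\<close> cancels the first. Applied to leaves, the odd set is the determining
  set.\<close>

lemma value_prod_odd: "value_prod v M = value_prod v (mset_set {x. odd (count M x)})"
proof (induction M)
  case (add x M)
  let ?O = "{y. odd (count M y)}"
  \<comment> \<open>\<open>mset_set\<close> of an infinite set is empty, so finiteness must be
    secured first.\<close>
  have fin: "finite ?O"
    by (rule finite_subset[of _ "set_mset M"]) (auto dest: odd_pos)
  show ?case
  proof (cases "x \<in> ?O")
    case True
    have "{y. odd (count (add_mset x M) y)} = ?O - {x}" using True by auto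
    moreover have "mset_set ?O = add_mset x (mset_set (?O - {x}))"
      by (rule mset_set.remove[OF fin True])
    then have "value_prod v M = v x ** value_prod v (mset_set (?O - {x}))"
      using add by simp
    ultimately show ?thesis
      by (simp only: value_prod_add square_assoc)
  next
    case False
    have "{y. odd (count (add_mset x M) y)} = insert x ?O" using False by auto
    then show ?thesis using add False fin by simp
  qed
qed simp

end

section \<open>Class representatives and the factorisation of tree nodes\<close>

lemma contextual_imp_pattern:
  assumes "contextual S" "S \<subseteq> pauli_ops"
  shows "\<exists>a\<in>S. \<exists>b\<in>S. \<exists>c\<in>S. \<exists>d\<in>S. contextual_pattern a b c d"
proof (rule ccontr)
  assume no_pattern: "\<not> ?thesis"
  define K where "K = {x \<in> S. \<exists>d\<in>S. \<not> commute x d}"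
  \<comment> \<open>If \<open>b\<close> and \<open>c\<close> anticommuted, then \<open>a\<close> and
    an operator anticommuting with it would complete the pattern.\<close>
  have trans: "commute b c" if "a \<in> K" "b \<in> S" "c \<in> S" "commute a b" "commute a c" for a b c
    using no_pattern that by (auto simp: K_def contextual_pattern_def)
  define r where "r x = (if x \<in> K then SOME y. y \<in> K \<and> commute x y else mat 1)" for x
  \<comment> \<open>The default \<open>mat 1\<close> outside \<open>S\<close> makes the locale
    assumptions hold for every argument.\<close>
  define v where "v x = (if x \<in> S then x ** r x else mat 1)" for x
  have KS: "K \<subseteq> S" by (auto simp: K_def)
  have r: "r x \<in> K \<and> commute x (r x)" if "x \<in> K" for x
    using that someI[of "\<lambda>y. y \<in> K \<and> commute x y" x] by (simp add: r_def)
  have rP: "r x \<in> pauli_ops" if "x \<in> K" for x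
    using r[OF that] KS assms(2) by blast
  have r_eq: "r x = r y" if "x \<in> K" "y \<in> K" "commute x y" for x y
  proof -
    have "x \<in> S" "y \<in> S" "commute y x"
      using that KS commute_sym[of x y] by blast+
    then have "commute x z \<longleftrightarrow> commute y z" if "z \<in> S" for z
      using trans[OF \<open>x \<in> K\<close>, of y z] trans[OF \<open>y \<in> K\<close>, of x z] that \<open>commute x y\<close> by blast
    \<comment> \<open>Equal predicates make \<open>SOME\<close> choose the same element, so
      \<open>r\<close> is constant on classes.\<close>
    then have "(\<lambda>z. z \<in> K \<and> commute x z) = (\<lambda>z. z \<in> K \<and> commute y z)"
      using KS by blast
    then show ?thesis using that by (simp add: r_def)
  qed
  have vS: "commute (v x) y" if "y \<in> S" for x y
  proof (cases "x \<in> K")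
    case True
    note rx = r[OF True]
    have S: "x \<in> S" "r x \<in> S" using True rx KS by auto
    \<comment> \<open>Hence moving \<open>y\<close> past \<open>x ** r x\<close> gives either no
      sign or two.\<close>
    have "commute x y \<longleftrightarrow> commute (r x) y"
      using trans[of x "r x" y] trans[of "r x" x y] True rx S that commute_sym[of x "r x"] by blast
    then have "commute (x ** r x) y"
      using commute_mult[of x y "r x"] commute_mult_anti[of x y "r x"] S that assms(2)
        pauli_anticommute(1)[of x y] pauli_anticommute(1)[of "r x" y] by blast
    then show ?thesis using S by (simp add: v_def)
  next
    case False
    then show ?thesis using that by (auto simp: v_def r_def K_def)
  qed
  have vr: "commute (v x) (r y)" for x y
    using vS r KS by (cases "y \<in> K") (auto simp: r_def)
  interpret commuting_involutions v
  proof
    show "v x ** v y = v y ** v x" for x y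
    proof (cases "y \<in> S")
      case True
      then have "commute y (v x)" "commute (r y) (v x)"
        using vS[of y x] vr[of x y] by (simp_all add: commute_def)
      then have "commute (y ** r y) (v x)" by (rule commute_mult)
      then show ?thesis using True by (simp add: v_def[of y] commute_def)
    qed (simp add: v_def)
    show "v x ** v x = mat 1" for x
    proof (cases "x \<in> K")
      case True
      then have P: "x \<in> pauli_ops" "r x \<in> pauli_ops" "x \<in> S" and c: "x ** r x = r x ** x"
        using r KS assms(2) by (auto simp: commute_def)
      have "(x ** r x) ** (x ** r x) = x ** (r x ** x) ** r x" by (simp add: matrix_mul_assoc)
      also have "\<dots> = (x ** x) ** (r x ** r x)"
        by (simp flip: c add: matrix_mul_assoc)
      finally show ?thesis using P by (simp add: v_def)
    next
      case False
      then show ?thesis using assms(2) by (auto simp: v_def r_def)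
    qed
  qed
  let ?\<Phi> = "value_prod v"
  \<comment> \<open>The possible remainders of a node once the \<open>v\<close>-product of its
    leaves is split off.\<close>
  define T where "T = insert (mat 1) (r ` K)"
  have T_square: "p ** p = mat 1" if "p \<in> T" for p
    using that rP by (auto simp: T_def)
  have \<Phi>T: "?\<Phi> M ** p = p ** ?\<Phi> M" if "p \<in> T" for M p
    using that vr by (intro value_prod_commute) (auto simp: T_def commute_def)
  have \<Phi>_cancel: "X = Y" if "?\<Phi> M ** X = ?\<Phi> M ** Y" for M X Y
  proof -
    have "?\<Phi> M ** (?\<Phi> M ** X) = ?\<Phi> M ** (?\<Phi> M ** Y)" using that by simp
    then show ?thesis by (simp add: matrix_mul_assoc value_prod_self)
  qed
  \<comment> \<open>Two commuting representatives would, by transitivity, put \<open>x\<close> and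
    \<open>y\<close> into one class; so distinct members of \<open>T\<close> other than
    \<open>mat 1\<close> do not commute.\<close>
  have T_commute: "p = q \<or> p = mat 1 \<or> q = mat 1" if pq: "p \<in> T" "q \<in> T" "commute p q" for p q
  proof (rule ccontr)
    assume neq: "\<not> ?thesis"
    then obtain x y where xy: "x \<in> K" "y \<in> K" "p = r x" "q = r y"
      using pq by (auto simp: T_def)
    note rxy = r[OF xy(1)] r[OF xy(2)]
    have "commute x (r y)"
      using trans[of "r x" x "r y"] xy rxy KS pq commute_sym[of x "r x"] by blast
    then have "commute x y"
      using trans[of "r y" x y] xy rxy KS commute_sym[of x "r y"] commute_sym[of y "r y"] by blast
    then have "r x = r y" using r_eq xy by blast
    then show False using xy neq by simp
  qed
  have factor: "\<exists>p\<in>T. root t = ?\<Phi> (leaves t) ** p" if "determining_tree S t" for t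
    using that
  proof (induction rule: determining_tree.induct)
    case (leaf x)
    have "v x ** r x = x"
    proof (cases "x \<in> K")
      case True
      have "v x ** r x = x ** (r x ** r x)"
        using leaf by (simp add: v_def matrix_mul_assoc)
      then show ?thesis using rP[OF True] by simp
    qed (use leaf in \<open>simp add: v_def r_def\<close>)
    moreover have "r x \<in> T"
      by (cases "x \<in> K") (simp_all add: T_def r_def)
    ultimately show ?case by (intro bexI[of _ "r x"]) simp_all
  next
    case (parent A ts)
    have "\<forall>t\<in>set ts. \<exists>p\<in>T. root t = ?\<Phi> (leaves t) ** p" using parent by blast
    then obtain p where p: "\<And>t. t \<in> set ts \<Longrightarrow> p t \<in> T \<and> root t = ?\<Phi> (leaves t) ** p t"
      by metis
    \<comment> \<open>Both orders of multiplying two roots carry the same \<open>v\<close>-product.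
      It cancels, so commutation passes from the children to their remainders.\<close>
    have p_commute: "commute (p s) (p t)" if st: "s \<in> set ts" "t \<in> set ts" for s t
    proof -
      have *: "root x ** root y = ?\<Phi> (leaves x + leaves y) ** (p x ** p y)"
        if "x \<in> set ts" "y \<in> set ts" for x y
      proof -
        have "root x ** root y = ?\<Phi> (leaves x) ** (p x ** ?\<Phi> (leaves y)) ** p y"
          using p that by (simp add: matrix_mul_assoc)
        also have "p x ** ?\<Phi> (leaves y) = ?\<Phi> (leaves y) ** p x"
          using \<Phi>T p[OF that(1)] by simp
        finally show ?thesis
          by (simp add: value_prod_union matrix_mul_assoc)
      qed
      have "root s ** root t = root t ** root s"
        using parent st by (simp add: commute_def)
      then have "?\<Phi> (leaves s + leaves t) ** (p s ** p t)
          = ?\<Phi> (leaves s + leaves t) ** (p t ** p s)"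
        using *[OF st] *[OF st(2,1)] by (simp add: add.commute)
      then show ?thesis using \<Phi>_cancel unfolding commute_def by blast
    qed
    \<comment> \<open>Commuting remainders take at most one value besides
      \<open>mat 1\<close>.\<close>
    obtain q where q: "q \<in> T" "\<And>t. t \<in> set ts \<Longrightarrow> p t \<in> {mat 1, q}"
    proof (cases "\<exists>s\<in>set ts. p s \<noteq> mat 1")
      case True
      then show ?thesis using that T_commute p p_commute by blast
    next
      case False
      then show ?thesis using that[of "mat 1"] by (auto simp: T_def)
    qed
    \<comment> \<open>Stated for all lists of children so that the induction keeps one
      \<open>q\<close>; \<open>{mat 1, q}\<close> is closed under products because
      \<open>q ** q = mat 1\<close>.\<close>
    have "\<exists>p\<in>{mat 1, q}. foldr (**) (map root us) (mat 1)
        = ?\<Phi> (\<Sum>\<^sub># (mset (map leaves us))) ** p" if "set us \<subseteq> set ts" for us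
      using that
    proof (induction us)
      case (Cons u us)
      from Cons.prems have "set us \<subseteq> set ts" by simp
      then obtain p' where p': "p' \<in> {mat 1, q}" "foldr (**) (map root us) (mat 1)
        = ?\<Phi> (\<Sum>\<^sub># (mset (map leaves us))) ** p'" using Cons.IH by blast
      have "foldr (**) (map root (u # us)) (mat 1)
          = ?\<Phi> (leaves u) ** (p u ** ?\<Phi> (\<Sum>\<^sub># (mset (map leaves us)))) ** p'"
        using p' p[of u] Cons.prems by (simp add: matrix_mul_assoc)
      also have "p u ** ?\<Phi> (\<Sum>\<^sub># (mset (map leaves us)))
          = ?\<Phi> (\<Sum>\<^sub># (mset (map leaves us))) ** p u"
        using \<Phi>T p[of u] Cons.prems by simp
      finally have "foldr (**) (map root (u # us)) (mat 1)
          = ?\<Phi> (\<Sum>\<^sub># (mset (map leaves (u # us)))) ** (p u ** p')"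
        by (simp add: value_prod_union matrix_mul_assoc)
      moreover have "p u ** p' \<in> {mat 1, q}"
        using q(2)[of u] p'(1) Cons.prems T_square[OF q(1)] by auto
      ultimately show ?case by blast
    qed simp
    from this[of ts] show ?case
      using parent q(1) by (auto simp: T_def)
  qed
  obtain \<tau> \<tau>' where \<tau>: "determining_tree S \<tau>" "determining_tree S \<tau>'"
    "root \<tau>' = - root \<tau>" "determining_set \<tau> = determining_set \<tau>'"
    using assms(1) by (auto simp: contextual_def)
  then have \<Phi>_eq: "?\<Phi> (leaves \<tau>) = ?\<Phi> (leaves \<tau>')"
    by (metis determining_set_def value_prod_odd)
  obtain p q where pq: "p \<in> T" "q \<in> T" "root \<tau> = ?\<Phi> (leaves \<tau>) ** p"
    "root \<tau>' = ?\<Phi> (leaves \<tau>') ** q"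
    using factor \<tau> by metis
  have "?\<Phi> (leaves \<tau>) ** q = ?\<Phi> (leaves \<tau>) ** (- p)"
    using pq \<Phi>_eq \<tau>(3) by simp
  then have q_eq: "q = - p" by (rule \<Phi>_cancel)
  \<comment> \<open>-1 commutes with everything, so it is not in \<open>K\<close> and cannot be a
    representative.\<close>
  have no_minus: "- mat 1 \<notin> T"
  proof
    assume "- mat 1 \<in> T"
    then have "- mat 1 \<in> K" using r mat_1_neq_uminus by (auto simp: T_def)
    then show False by (auto simp: K_def commute_def)
  qed
  \<comment> \<open>Opposite remainders commute, so \<open>T_commute\<close> leaves three cases:
    equality gives 1 = -1, and the other two put \<open>- mat 1\<close> into
    \<open>T\<close>.\<close>
  have "commute p q" using q_eq by (simp add: commute_def)
  from T_commute[OF pq(1,2) this] show False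
  proof (elim disjE)
    assume "p = q"
    then have "p ** p = p ** q" by simp
    also have "\<dots> = - (p ** p)" using q_eq by simp
    finally show False using T_square[OF pq(1)] by (simp add: mat_1_neq_uminus)
  next
    assume "p = mat 1" then show False using q_eq pq no_minus by simp
  next
    have "p = - q" using q_eq by simp
    moreover assume "q = mat 1"
    ultimately show False using pq(1) no_minus by simp
  qed
qed

text \<open>Holds for sets of any size: contextuality is always witnessed by four operators.\<close>

theorem contextual_iff_pattern:
  assumes "S \<subseteq> pauli_ops"
  shows "contextual S \<longleftrightarrow> (\<exists>a\<in>S. \<exists>b\<in>S. \<exists>c\<in>S. \<exists>d\<in>S. contextual_pattern a b c d)"
  using assms contextual_imp_pattern contextual_of_pattern by blast

section \<open>Graphs on four vertices\<close>

lemma compatibility_edge_iff: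
  "{x, y} \<in> snd (compatibility_graph S) \<longleftrightarrow> x \<in> S \<and> y \<in> S \<and> x \<noteq> y \<and> commute x y"
  by (auto simp: compatibility_graph_def doubleton_eq_iff commute_sym)

lemma compatibility_graph_four:
  assumes "distinct [a, b, c, d]"
  shows "snd (compatibility_graph {a, b, c, d}) =
    (if commute a b then {{a, b}} else {}) \<union> (if commute a c then {{a, c}} else {}) \<union>
    (if commute a d then {{a, d}} else {}) \<union> (if commute b c then {{b, c}} else {}) \<union>
    (if commute b d then {{b, d}} else {}) \<union> (if commute c d then {{c, d}} else {})"
    (is "?L = ?R")
proof
  show "?R \<subseteq> ?L"
    using assms by (auto simp: compatibility_edge_iff)
  show "?L \<subseteq> ?R"
    by (force simp: compatibility_graph_def commute_sym insert_commute)
qed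

text \<open>The map sending the first list to the second is onto a finite set, hence injective; it
  is the identity elsewhere.\<close>

lemma permutes_four_obtain:
  assumes "distinct [A, B, C, D]" "{a, b, c, d} = {A, B, C, D}"
  obtains \<pi> where "\<pi> permutes {A, B, C, D}" "\<pi> A = a" "\<pi> B = b" "\<pi> C = c" "\<pi> D = d"
proof
  let ?\<pi> = "id(A := a, B := b, C := c, D := d)"
  show v: "?\<pi> A = a" "?\<pi> B = b" "?\<pi> C = c" "?\<pi> D = d"
    using assms(1) by auto
  have img: "?\<pi> ` {A, B, C, D} = {A, B, C, D}"
    by (simp only: image_insert image_empty v assms(2))
  then have "inj_on ?\<pi> {A, B, C, D}"
    by (intro finite_surj_inj) simp_all
  then have "bij_betw ?\<pi> {A, B, C, D} {A, B, C, D}"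
    using img by (simp only: bij_betw_def simp_thms)
  then show "?\<pi> permutes {A, B, C, D}"
    by (rule bij_imp_permutes) auto
qed

definition contextual_graph ::
  "'n::finite qop set \<Rightarrow> 'n qop \<Rightarrow> 'n qop \<Rightarrow> 'n qop \<Rightarrow> 'n qop \<Rightarrow> bool" where
  "contextual_graph S a b c d \<longleftrightarrow>
     compatibility_graph S = (S, {{a, b}, {a, c}}) \<or>
     compatibility_graph S = (S, {{a, b}, {a, c}, {b, d}}) \<or>
     compatibility_graph S = (S, {{a, b}, {a, c}, {b, d}, {c, d}})"

lemma pattern_distinct: "contextual_pattern a b c d \<Longrightarrow> distinct [a, b, c, d]"
  by (auto simp: contextual_pattern_def commute_sym)

text \<open>The pattern leaves only the edges \<open>{b, d}\<close> and \<open>{c, d}\<close> free.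
  If \<open>{c, d}\<close> alone is present, the graph is the four-vertex path with \<open>b\<close>
  and \<open>c\<close> exchanged.\<close>

lemma contextual_graph_of_pattern:
  assumes "contextual_pattern a b c d" "S = {a, b, c, d}"
  shows "contextual_graph S a b c d \<or> contextual_graph S a c b d"
proof -
  have "snd (compatibility_graph S) = {{a, b}, {a, c}} \<union>
    (if commute b d then {{b, d}} else {}) \<union> (if commute c d then {{c, d}} else {})"
    using compatibility_graph_four[OF pattern_distinct[OF assms(1)]] assms
    by (simp add: contextual_pattern_def insert_commute)
  moreover have "fst (compatibility_graph S) = S" by (simp add: compatibility_graph_def)
  ultimately show ?thesis
    unfolding contextual_graph_def
    by (cases "compatibility_graph S") (auto simp: insert_commute)
qed

text \<open>All three graphs contain \<open>{a, b}\<close> and \<open>{a, c}\<close> and lack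
  \<open>{b, c}\<close> and \<open>{a, d}\<close>; distinctness keeps these pairs apart from the
  listed edges.\<close>

lemma pattern_of_contextual_graph:
  assumes "contextual_graph S a b c d" "S = {a, b, c, d}" "distinct [a, b, c, d]"
  shows "contextual_pattern a b c d"
proof -
  have "commute x y \<longleftrightarrow> {x, y} \<in> snd (compatibility_graph S)"
    if "x \<in> S" "y \<in> S" "x \<noteq> y" for x y
    using that by (simp add: compatibility_edge_iff)
  then show ?thesis
    using assms unfolding contextual_graph_def contextual_pattern_def
    by (auto simp: doubleton_eq_iff)
qed

theorem theorem1:
  fixes A B C D :: "complex ^ (2 ^ 'n::finite) ^ (2 ^ 'n)"
  assumes "A \<in> pauli_ops" and "B \<in> pauli_ops" and "C \<in> pauli_ops" and "D \<in> pauli_ops"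
    and "distinct [A, B, C, D]"
  shows "contextual {A, B, C, D} \<longleftrightarrow>
    (\<exists>\<pi>. \<pi> permutes {A, B, C, D} \<and>
      (compatibility_graph {A, B, C, D} =
         ({A, B, C, D}, {{\<pi> A, \<pi> B}, {\<pi> A, \<pi> C}}) \<or>
       compatibility_graph {A, B, C, D} =
         ({A, B, C, D}, {{\<pi> A, \<pi> B}, {\<pi> A, \<pi> C}, {\<pi> B, \<pi> D}}) \<or>
       compatibility_graph {A, B, C, D} =
         ({A, B, C, D}, {{\<pi> A, \<pi> B}, {\<pi> A, \<pi> C}, {\<pi> B, \<pi> D}, {\<pi> C, \<pi> D}})))"
proof -
  let ?S = "{A, B, C, D}"
  have "(\<exists>a\<in>?S. \<exists>b\<in>?S. \<exists>c\<in>?S. \<exists>d\<in>?S. contextual_pattern a b c d) \<longleftrightarrow>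
    (\<exists>\<pi>. \<pi> permutes ?S \<and> contextual_graph ?S (\<pi> A) (\<pi> B) (\<pi> C) (\<pi> D))"
  proof
    assume "\<exists>a\<in>?S. \<exists>b\<in>?S. \<exists>c\<in>?S. \<exists>d\<in>?S. contextual_pattern a b c d"
    then obtain a b c d where mem: "{a, b, c, d} \<subseteq> ?S" and pat: "contextual_pattern a b c d"
      by (metis insert_subset empty_subsetI)
    note dist = pattern_distinct[OF pat]
    have "card {a, b, c, d} = card ?S" using dist assms(5) by simp
    then have S: "{a, b, c, d} = ?S" using mem by (intro card_subset_eq) auto
    obtain b' c' where bc: "contextual_graph ?S a b' c' d" "{a, b', c', d} = ?S"
    proof (cases "contextual_graph ?S a b c d")
      case True
      then show ?thesis using that S by blast
    next
      case False
      then have "contextual_graph ?S a c b d"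
        using contextual_graph_of_pattern[OF pat] S by simp
      then show ?thesis using that[of c b] S by (simp only: insert_commute)
    qed
    then show "\<exists>\<pi>. \<pi> permutes ?S \<and> contextual_graph ?S (\<pi> A) (\<pi> B) (\<pi> C) (\<pi> D)"
      using permutes_four_obtain[OF assms(5) bc(2)] by metis
  next
    assume "\<exists>\<pi>. \<pi> permutes ?S \<and> contextual_graph ?S (\<pi> A) (\<pi> B) (\<pi> C) (\<pi> D)"
    then obtain \<pi> where \<pi>: "\<pi> permutes ?S" and
      graph: "contextual_graph ?S (\<pi> A) (\<pi> B) (\<pi> C) (\<pi> D)" by blast
    have S: "?S = {\<pi> A, \<pi> B, \<pi> C, \<pi> D}"
      using permutes_image[OF \<pi>] by simp
    have "distinct [\<pi> A, \<pi> B, \<pi> C, \<pi> D]"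
      using assms(5) permutes_inj[OF \<pi>] by (auto simp: inj_eq)
    then have "contextual_pattern (\<pi> A) (\<pi> B) (\<pi> C) (\<pi> D)"
      using pattern_of_contextual_graph graph S by blast
    moreover have "\<pi> x \<in> ?S" if "x \<in> ?S" for x
      using permutes_in_image[OF \<pi>] that by blast
    ultimately show "\<exists>a\<in>?S. \<exists>b\<in>?S. \<exists>c\<in>?S. \<exists>d\<in>?S. contextual_pattern a b c d"
      by blast
  qed
  moreover have "?S \<subseteq> pauli_ops" using assms by simp
  note contextual_iff_pattern[OF this]
  ultimately show ?thesis
    unfolding contextual_graph_def by (rule trans[rotated])
qed

end
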